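(* Let $N\in\mathbb{N}$ and $\gamma\in\mathcal{PW}_{\le N}$. Then: (i) For each family of non-negative integers $(m_w)_{w\in\mathcal{W}^*_{\le N}(\gamma)}$ such that $\|w\|+m_w\le N$ for each $w\in\mathcal{W}^*_{\le N}(\gamma)$, the set $\{w\,0_{m_w} : w\in\mathcal{W}^*_{\le N}(\gamma)\}$ is a basis of words for $\mathcal{W}_N(\gamma)$. (ii) For each family of non-negative integers $(m_w)_{w\in{}^*\mathcal{W}_{\le N}(\gamma)}$ such that $\|w\|+m_w\le N$ for each $w\in{}^*\mathcal{W}_{\le N}(\gamma)$, the set $\{0_{m_w}\,w : w\in{}^*\mathcal{W}_{\le N}(\gamma)\}$ is a basis of words for $\mathcal{W}_N(\gamma)$.
   Context: $\mathbb{N}=\{0,1,2,\dots\}$. Fix an integer $d\ge 1$ and the alphabet $\mathcal{A}=\{0,1,\dots,d\}$. $\mathcal{W}_N$ is the set of words of length $N$ over $\mathcal{A}$ (with $\mathcal{W}_0=\{\epsilon\}$, $\epsilon$ the empty word), $\mathcal{W}_{\le N}=\bigsqcup_{k=0}^N\mathcal{W}_k$, $\mathcal{W}_{<\infty}=\bigsqcup_{k\ge0}\mathcal{W}_k$; $\|w\|$ is the length of a word $w$; $0_k$ is the word made of $k$ letters $0$ ($0_0=\epsilon$); juxtaposition of words denotes concatenation. For a set $C$ of words, $\mathrm{Span}(C)$ is the real vector space of formal finite linear combinations of elements of $C$. Concatenation of words is extended bilinearly to $\mathrm{Span}(\mathcal{W}_{<\infty})$. The shuffle product $\sqcup\!\sqcup$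 is defined inductively by $w\sqcup\!\sqcup\epsilon=\epsilon\sqcup\!\sqcup w=w$ and $(wi)\sqcup\!\sqcup(vj)=(w\sqcup\!\sqcup(vj))i+((wi)\sqcup\!\sqcup v)j$ for words $w,v$ and letters $i,j$, and extended bilinearly. For a word $w$, $P(w)$ is the word obtained by deleting all letters $0$ from $w$. $\mathcal{PW}_{\le N}=P(\mathcal{W}_{\le N})$ is the set of words of length at most $N$ with no letter $0$ (pure words). For $\gamma\in \mathcal{PW}_{\le N}$: $\mathcal{W}_N(\gamma)=\{w\in\mathcal{W}_N: P(w)=\gamma\}$ and $\mathcal{W}_{\le N}(\gamma)=\{w\in\mathcal{W}_{\le N}:P(w)=\gamma\}$. A subset $B\subset\mathcal{W}_{\le N}(\gamma)$ is a basis of words for $\mathcal{W}_N(\gamma)$ if the family $(w\sqcup\!\sqcup 0_{N-\|w\|})_{w\in B}$ is a basis of $\mathrm{Span}(\mathcal{W}_N(\gamma))$. $\mathcal{W}^*_{\le N}(\gamma)$ is the set of words in $\mathcal{W}_{\le N}(\gamma)$ that are either empty or whose last letter is not $0$ ($\gamma$-prefixes); ${}^*\mathcal{W}_{\le N}(\gamma)$ is the set of words in $\mathcal{W}_{\le N}(\gamma)$ that are either empty or whose first letter is not $0$ ($\gamma$-suffixes). *)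

theory Defs
  imports "HOL-Analysis.Finite_Function_Topology"
begin

type_synonym word = "nat list"

(* Formal finite real linear combinations of words.  The real vector space structure on
   this type comes from HOL-Analysis.Finite_Function_Topology. *)
type_synonym comb = "word \<Rightarrow>\<^sub>0 real"

abbreviation of_word :: "word \<Rightarrow> comb" where
  "of_word w \<equiv> Poly_Mapping.single w 1"

definition Span :: "word set \<Rightarrow> comb set" where
  "Span C = span (of_word ` C)"

definition bilinear_ext :: "(word \<Rightarrow> word \<Rightarrow> comb) \<Rightarrow> comb \<Rightarrow> comb \<Rightarrow> comb" where
  "bilinear_ext f p q =
     (\<Sum>u\<in>Poly_Mapping.keys p. \<Sum>v\<in>Poly_Mapping.keys q.
        (Poly_Mapping.lookup p u * Poly_Mapping.lookup q v) *\<^sub>R f u v)"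

definition conc :: "comb \<Rightarrow> comb \<Rightarrow> comb" where
  "conc = bilinear_ext (\<lambda>u v. of_word (u @ v))"

(* Multiplicities matter here, so the set-valued List.shuffles is not the right notion. *)
function shuffle_words :: "word \<Rightarrow> word \<Rightarrow> comb" where
  "shuffle_words w [] = of_word w"
| "shuffle_words [] w = of_word w"
| "shuffle_words (w @ [i]) (v @ [j]) =
     conc (shuffle_words w (v @ [j])) (of_word [i]) +
     conc (shuffle_words (w @ [i]) v) (of_word [j])"
proof -
  fix P :: bool and x :: "word \<times> word"
  assume 1: "\<And>w. x = (w, []) \<Longrightarrow> P"
    and 2: "\<And>w. x = ([], w) \<Longrightarrow> P"
    and 3: "\<And>w i v j. x = (w @ [i], v @ [j]) \<Longrightarrow> P"
  obtain a b where x: "x = (a, b)" by (cases x)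
  show P
    by (cases a rule: rev_cases; cases b rule: rev_cases) (use 1 2 3 x in auto)
qed auto
termination by (relation "measure (\<lambda>(w, v). length w + length v)") auto

definition shuffle :: "comb \<Rightarrow> comb \<Rightarrow> comb" where
  "shuffle = bilinear_ext shuffle_words"

definition zeros :: "nat \<Rightarrow> word" where
  "zeros k = replicate k 0"

definition words :: "nat \<Rightarrow> nat \<Rightarrow> word set" where
  "words d N = {w. set w \<subseteq> {0..d} \<and> length w = N}"

definition words_le :: "nat \<Rightarrow> nat \<Rightarrow> word set" where
  "words_le d N = (\<Union>k\<in>{0..N}. words d k)"

definition purify :: "word \<Rightarrow> word" where
  "purify w = filter (\<lambda>i. i \<noteq> 0) w"

definition pure_words_le :: "nat \<Rightarrow> nat \<Rightarrow> word set" where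
  "pure_words_le d N = purify ` words_le d N"

definition words_over :: "nat \<Rightarrow> nat \<Rightarrow> word \<Rightarrow> word set" where
  "words_over d N \<gamma> = {w \<in> words d N. purify w = \<gamma>}"

definition words_le_over :: "nat \<Rightarrow> nat \<Rightarrow> word \<Rightarrow> word set" where
  "words_le_over d N \<gamma> = {w \<in> words_le d N. purify w = \<gamma>}"

definition prefixes_over :: "nat \<Rightarrow> nat \<Rightarrow> word \<Rightarrow> word set" where
  "prefixes_over d N \<gamma> = {w \<in> words_le_over d N \<gamma>. w = [] \<or> last w \<noteq> 0}"

definition suffixes_over :: "nat \<Rightarrow> nat \<Rightarrow> word \<Rightarrow> word set" where
  "suffixes_over d N \<gamma> = {w \<in> words_le_over d N \<gamma>. w = [] \<or> hd w \<noteq> 0}"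

(* Injectivity is needed because the basis is a family, not just a set of vectors. *)
definition basis_family :: "('i \<Rightarrow> comb) \<Rightarrow> 'i set \<Rightarrow> comb set \<Rightarrow> bool" where
  "basis_family f I V \<longleftrightarrow> inj_on f I \<and> independent (f ` I) \<and> span (f ` I) = V"

definition basis_of_words :: "nat \<Rightarrow> nat \<Rightarrow> word \<Rightarrow> word set \<Rightarrow> bool" where
  "basis_of_words d N \<gamma> B \<longleftrightarrow>
     B \<subseteq> words_le_over d N \<gamma> \<and>
     basis_family (\<lambda>w. shuffle (of_word w) (of_word (zeros (N - length w)))) B
       (Span (words_over d N \<gamma>))"

end

theory Submission
  imports Defs "HOL-Library.Sublist"
begin

text \<open>
  The shuffle of a word \<open>b\<close> with zeros is a combination, with nonnegative coefficients, of words
  having \<open>b\<close> as a subsequence, and the coefficient of \<open>b\<close> padded with zeros on either side is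
  positive.  Let \<open>b = w 0\<^sub>m\<close> with \<open>w\<close> a prefix.  A word \<open>u\<close> having \<open>w\<close> as a subsequence still does
  after its trailing zeros are removed, so the prefix of \<open>u\<close> is either \<open>w\<close> itself or strictly
  longer.  Hence the shuffles are triangular with nonzero diagonal with respect to the
  words over \<open>\<gamma>\<close>, ordered by the length of their prefixes.  The same works for suffixes.
\<close>

section \<open>Formal combinations of words\<close>

lemma lookup_scaleR:
  fixes p :: "'a \<Rightarrow>\<^sub>0 'b::real_vector"
  shows "Poly_Mapping.lookup (c *\<^sub>R p) u = c *\<^sub>R Poly_Mapping.lookup p u"
proof -
  \<comment> \<open>Scalar multiplication abstracts a function to a finitely supported one, so its
    coefficients can be read off only once the support is known to be finite.\<close>
  have "finite {i. c *\<^sub>R Poly_Mapping.lookup p i \<noteq> 0}"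
    by (rule finite_subset[OF _ finite_keys[of p]]) (auto simp: in_keys_iff)
  then show ?thesis
    by (simp add: scaleR_poly_mapping_def)
qed

lemma comb_eq_sum_keys:
  fixes p :: comb
  shows "p = (\<Sum>u\<in>Poly_Mapping.keys p. Poly_Mapping.lookup p u *\<^sub>R of_word u)"
  by (rule poly_mapping_eqI)
    (auto simp: lookup_sum lookup_scaleR lookup_single when_def if_distrib in_keys_iff cong: if_cong)

lemma in_SpanI:
  assumes "\<And>u. Poly_Mapping.lookup p u \<noteq> 0 \<Longrightarrow> u \<in> A"
  shows "p \<in> Span A"
proof -
  have "(\<Sum>u\<in>Poly_Mapping.keys p. Poly_Mapping.lookup p u *\<^sub>R of_word u) \<in> Span A"
    unfolding Span_def using assms
    by (intro span_sum span_scale span_base) (auto simp: in_keys_iff)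
  then show ?thesis
    by (simp flip: comb_eq_sum_keys)
qed

lemma inj_of_word: "inj of_word"
  by (rule injI) (metis lookup_single_eq lookup_single_not_eq zero_neq_one)

text \<open>The coefficient at \<open>u\<close> is a linear functional that is 1 on \<open>u\<close>
  and vanishes on the span of all other words.\<close>

lemma independent_of_word: "independent (of_word ` A)"
proof -
  have "of_word u \<notin> span (of_word ` A - {of_word u})" for u
  proof
    assume "of_word u \<in> span (of_word ` A - {of_word u})"
    moreover have "span (of_word ` A - {of_word u}) \<subseteq> {p. Poly_Mapping.lookup p u = 0}"
      by (rule span_minimal)
        (auto simp: subspace_def lookup_add lookup_scaleR lookup_single when_def)
    ultimately show False
      by auto
  qed
  then show ?thesis
    by (auto simp: dependent_def)
qed

text \<open>Back substitution expresses every word through the family, so the family spans. Since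
  the finite index set has as many elements as the words have dimension, a dimension count then
  yields both independence and injectivity.\<close>

lemma basis_family_triangular:
  fixes h :: "word \<Rightarrow> nat"
  assumes "finite S"
    and diag: "\<And>u. u \<in> S \<Longrightarrow> Poly_Mapping.lookup (f u) u \<noteq> 0"
    and supp: "\<And>u v. u \<in> S \<Longrightarrow> Poly_Mapping.lookup (f u) v \<noteq> 0 \<Longrightarrow> v \<in> S \<and> (v = u \<or> h u < h v)"
  shows "basis_family f S (Span S)"
proof -
  have f_in: "f ` S \<subseteq> Span S"
    using supp by (auto intro: in_SpanI)
  \<comment> \<open>Back substitution starts at the highest level of \<open>h\<close> and descends.
    Here \<open>c\<close> is the diagonal entry and \<open>r\<close> the off-diagonal part,
    supported on strictly higher levels.\<close>
  have word_in: "of_word u \<in> span (f ` S)" if "u \<in> S" for u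
    using that
  proof (induction "Max (h ` S) - h u" arbitrary: u rule: less_induct)
    case less
    define c where "c = Poly_Mapping.lookup (f u) u"
    define r where "r = f u - c *\<^sub>R of_word u"
    have r: "r \<in> Span {v \<in> S. h u < h v}"
    proof (rule in_SpanI)
      fix v assume "Poly_Mapping.lookup r v \<noteq> 0"
      then have "v \<noteq> u" "Poly_Mapping.lookup (f u) v \<noteq> 0"
        by (auto simp: r_def c_def lookup_minus lookup_scaleR lookup_single when_def split: if_splits)
      then show "v \<in> {v \<in> S. h u < h v}"
        using supp[OF less.prems] by auto
    qed
    have "of_word v \<in> span (f ` S)" if "v \<in> S" "h u < h v" for v
    proof (rule less.hyps)
      \<comment> \<open>Subtraction on \<open>nat\<close> truncates, so the measure drops strictly
        only because \<open>h v\<close> does not exceed the maximum.\<close>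
      have "h v \<le> Max (h ` S)"
        using that \<open>finite S\<close> by auto
      then show "Max (h ` S) - h v < Max (h ` S) - h u"
        using that by linarith
    qed (fact that)
    then have "Span {v \<in> S. h u < h v} \<subseteq> span (f ` S)"
      unfolding Span_def by (intro span_minimal) auto
    then have "f u - r \<in> span (f ` S)"
      using r less.prems by (intro span_diff) (auto intro: span_base)
    then have "(1 / c) *\<^sub>R (f u - r) \<in> span (f ` S)"
      by (rule span_scale)
    moreover have "(1 / c) *\<^sub>R (f u - r) = of_word u"
      using diag[OF less.prems] by (simp add: r_def c_def)
    ultimately show ?case
      by simp
  qed
  have span_eq: "span (f ` S) = Span S"
    using f_in word_in unfolding Span_def
    by (intro equalityI span_minimal subspace_span) auto
  \<comment> \<open>Count: card \<open>S\<close> \<le> card \<open>B\<close> \<le> card of the image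
    \<le> card \<open>S\<close>. Equality throughout makes the whole image independent and
    \<open>f\<close> injective.\<close>
  obtain B where B: "B \<subseteq> f ` S" "independent B" "f ` S \<subseteq> span B"
    by (rule maximal_independent_subset)
  have "finite B"
    using B(1) \<open>finite S\<close> finite_surj by blast
  have "of_word ` S \<subseteq> span B"
    using word_in span_minimal[OF B(3) subspace_span] by auto
  then have "card (of_word ` S) \<le> card B"
    using independent_span_bound[OF \<open>finite B\<close> independent_of_word] by blast
  moreover have "card (of_word ` S) = card S"
    by (rule card_image) (rule inj_on_subset[OF inj_of_word], simp)
  moreover have "card B \<le> card (f ` S)" "card (f ` S) \<le> card S"
    using B(1) \<open>finite S\<close> by (auto intro: card_mono card_image_le)
  ultimately have "card B = card (f ` S)" "card (f ` S) = card S"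
    by simp_all
  then have "B = f ` S" "inj_on f S"
    using card_subset_eq[OF _ B(1)] eq_card_imp_inj_on \<open>finite S\<close> by blast+
  then show ?thesis
    using B(2) span_eq by (simp add: basis_family_def)
qed

section \<open>Support of the shuffle product\<close>

lemma bilinear_ext_of_word [simp]: "bilinear_ext f (of_word u) (of_word v) = f u v"
  by (simp add: bilinear_ext_def)

text \<open>Appending a letter is injective on words, so at most one term contributes. This turns
  the recursion of \<open>shuffle_words\<close> into a recursion on coefficients.\<close>

lemma lookup_conc_letter:
  "Poly_Mapping.lookup (conc p (of_word [i])) u =
     (if u \<noteq> [] \<and> last u = i then Poly_Mapping.lookup p (butlast u) else 0)"
proof -
  have snoc: "(x @ [i] = u) = (u \<noteq> [] \<and> last u = i \<and> x = butlast u)" for x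
    by auto
  have "Poly_Mapping.lookup (conc p (of_word [i])) u =
      (\<Sum>x\<in>Poly_Mapping.keys p. if u \<noteq> [] \<and> last u = i \<and> x = butlast u then Poly_Mapping.lookup p x else 0)"
    by (auto simp: conc_def bilinear_ext_def lookup_sum lookup_scaleR lookup_single when_def snoc
        intro!: sum.cong)
  also have "\<dots> = (if u \<noteq> [] \<and> last u = i then Poly_Mapping.lookup p (butlast u) else 0)"
    by (auto simp: in_keys_iff)
  finally show ?thesis .
qed

text \<open>The recursion only adds, so no cancellation occurs and one positive summand suffices for
  positivity.\<close>

lemma lookup_shuffle_words_nonneg: "0 \<le> Poly_Mapping.lookup (shuffle_words w v) u"
  by (induction w v arbitrary: u rule: shuffle_words.induct)
    (auto simp: lookup_single when_def lookup_add lookup_conc_letter)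

lemma shuffle_words_support:
  assumes "Poly_Mapping.lookup (shuffle_words w v) u \<noteq> 0"
  shows "length u = length w + length v" and "subseq w u"
    and "set v \<subseteq> {0} \<Longrightarrow> purify u = purify w"
proof -
  have "length u = length w + length v \<and> subseq w u \<and> (set v \<subseteq> {0} \<longrightarrow> purify u = purify w)"
    using assms
  proof (induction w v arbitrary: u rule: shuffle_words.induct)
    case (1 w)
    then show ?case
      by (auto simp: lookup_single when_def split: if_splits)
  next
    case (2 w)
    then show ?case
      by (auto simp: lookup_single when_def purify_def filter_empty_conv split: if_splits)
  next
    case (3 w i v j)
    \<comment> \<open>The last letter of \<open>u\<close> comes from one of the two factors. If it
      comes from the second, dropping it keeps the subsequence, and if it is 0 the purification is
      unchanged.\<close>
    from "3.prems" consider
        x where "u = x @ [i]" "Poly_Mapping.lookup (shuffle_words w (v @ [j])) x \<noteq> 0"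
      | x where "u = x @ [j]" "Poly_Mapping.lookup (shuffle_words (w @ [i]) v) x \<noteq> 0"
      by (cases u rule: rev_cases) (fastforce simp: lookup_add lookup_conc_letter split: if_splits)+
    then show ?case
    proof cases
      case 1
      then show ?thesis
        using "3.IH"(1)[OF 1(2)] by (auto simp: purify_def)
    next
      case 2
      then show ?thesis
        using "3.IH"(2)[OF 2(2)] by (auto simp: purify_def intro: subseq_rev_drop_many)
    qed
  qed
  then show "length u = length w + length v" "subseq w u"
    "set v \<subseteq> {0} \<Longrightarrow> purify u = purify w"
    by auto
qed

text \<open>In the recursive case the first word gets a positive contribution from the second
  summand and the other word from the first summand; the remaining summand is nonnegative.\<close>

lemma lookup_shuffle_words_append_pos:
  "0 < Poly_Mapping.lookup (shuffle_words w v) (w @ v)"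
  "0 < Poly_Mapping.lookup (shuffle_words w v) (v @ w)"
proof (induction w v rule: shuffle_words.induct)
  case (3 w i v j)
  show
    "0 < Poly_Mapping.lookup (shuffle_words (w @ [i]) (v @ [j])) ((w @ [i]) @ (v @ [j]))"
    "0 < Poly_Mapping.lookup (shuffle_words (w @ [i]) (v @ [j])) ((v @ [j]) @ (w @ [i]))"
    using 3
    by (simp_all add: lookup_add lookup_conc_letter butlast_append lookup_shuffle_words_nonneg
        add_nonneg_pos add_pos_nonneg)
qed simp_all

section \<open>Words over a pure word\<close>

text \<open>Every letter is 0 or survives in \<gamma>. Membership over \<gamma> thus reduces to
  conditions on length and purification.\<close>

lemma set_subset_if_purify_eq:
  assumes "\<gamma> \<in> pure_words_le d N" and "purify w = \<gamma>"
  shows "set w \<subseteq> {0..d}"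
proof
  fix x assume "x \<in> set w"
  then have "x = 0 \<or> x \<in> set \<gamma>"
    using assms(2) by (auto simp: purify_def)
  moreover have "set \<gamma> \<subseteq> {0..d}"
    using assms(1) by (auto simp: pure_words_le_def words_le_def words_def purify_def)
  ultimately show "x \<in> {0..d}"
    by auto
qed

lemma words_over_eq:
  assumes "\<gamma> \<in> pure_words_le d N"
  shows "words_over d N \<gamma> = {w. length w = N \<and> purify w = \<gamma>}"
  using set_subset_if_purify_eq[OF assms] by (auto simp: words_over_def words_def)

lemma words_le_over_eq:
  assumes "\<gamma> \<in> pure_words_le d N"
  shows "words_le_over d N \<gamma> = {w. length w \<le> N \<and> purify w = \<gamma>}"
  using set_subset_if_purify_eq[OF assms]
  by (auto simp: words_le_over_def words_le_def words_def)

lemma finite_words_over: "finite (words_over d N \<gamma>)"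
  unfolding words_over_def words_def
  by (rule finite_subset[OF _ finite_lists_length_eq[of "{0..d}" N]]) auto

lemma length_zeros [simp]: "length (zeros k) = k"
  by (simp add: zeros_def)

lemma set_zeros: "set (zeros k) \<subseteq> {0}"
  by (auto simp: zeros_def)

lemma purify_append_zeros [simp]: "purify (w @ zeros k) = purify w" "purify (zeros k @ w) = purify w"
  by (simp_all add: purify_def zeros_def)

lemma zeros_add: "zeros (m + n) = zeros m @ zeros n"
  by (simp add: zeros_def replicate_add)

text \<open>Indexing the candidates as \<open>k u\<close> by the words \<open>u\<close> of length
  \<open>N\<close> makes the transition matrix square, with diagonal entry the coefficient of
  \<open>u\<close> in the shuffle of \<open>k u\<close> with zeros.\<close>

lemma basis_of_words_triangular:
  fixes h :: "word \<Rightarrow> nat"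
  assumes "\<gamma> \<in> pure_words_le d N"
    and k: "\<And>u. u \<in> words_over d N \<gamma> \<Longrightarrow> k u \<in> words_le_over d N \<gamma>"
    and diag: "\<And>u. u \<in> words_over d N \<gamma> \<Longrightarrow>
      u = k u @ zeros (N - length (k u)) \<or> u = zeros (N - length (k u)) @ k u"
    and tri: "\<And>u v. u \<in> words_over d N \<gamma> \<Longrightarrow> v \<in> words_over d N \<gamma> \<Longrightarrow> subseq (k u) v \<Longrightarrow>
      v = u \<or> h u < h v"
  shows "basis_of_words d N \<gamma> (k ` words_over d N \<gamma>)"
proof -
  define g where "g = (\<lambda>w. shuffle (of_word w) (of_word (zeros (N - length w))))"
  have g: "g w = shuffle_words w (zeros (N - length w))" for w
    by (simp add: g_def shuffle_def)
  have "basis_family (g \<circ> k) (words_over d N \<gamma>) (Span (words_over d N \<gamma>))"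
  proof (rule basis_family_triangular[where h = h])
    fix u assume u: "u \<in> words_over d N \<gamma>"
    show "Poly_Mapping.lookup ((g \<circ> k) u) u \<noteq> 0"
      using diag[OF u] lookup_shuffle_words_append_pos[of "k u" "zeros (N - length (k u))"]
      by (auto simp: g)
    fix v assume "Poly_Mapping.lookup ((g \<circ> k) u) v \<noteq> 0"
    then have "Poly_Mapping.lookup (shuffle_words (k u) (zeros (N - length (k u)))) v \<noteq> 0"
      by (simp add: g)
    note supp = shuffle_words_support[OF this]
    have "v \<in> words_over d N \<gamma>"
      using supp(1) supp(3)[OF set_zeros] k[OF u]
      by (simp add: words_over_eq[OF assms(1)] words_le_over_eq[OF assms(1)])
    then show "v \<in> words_over d N \<gamma> \<and> (v = u \<or> h u < h v)"
      using tri[OF u _ supp(2)] by simp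
  qed (rule finite_words_over)
  \<comment> \<open>Injectivity of \<open>g \<circ> k\<close> passes to \<open>g\<close> on the
    image of \<open>k\<close>, which is the required family indexed by candidate words.\<close>
  then have "basis_family g (k ` words_over d N \<gamma>) (Span (words_over d N \<gamma>))"
    by (auto simp: basis_family_def image_comp intro: inj_on_imageI)
  then show ?thesis
    using k by (auto simp: basis_of_words_def g_def)
qed

section \<open>Removing leading and trailing zeros\<close>

definition strip_left :: "word \<Rightarrow> word" where
  "strip_left u = dropWhile (\<lambda>i. i = 0) u"

text \<open>Defined by reversal so that its properties can be transferred from
  \<open>strip_left\<close>.\<close>

definition strip_right :: "word \<Rightarrow> word" where
  "strip_right u = rev (strip_left (rev u))"

lemma strip_left_decomp: "zeros (length u - length (strip_left u)) @ strip_left u = u"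
proof (induction u)
  case (Cons i u)
  then show ?case
    using length_dropWhile_le[of "\<lambda>i. i = 0" u]
    by (cases "i = 0") (simp_all add: strip_left_def zeros_def Suc_diff_le)
qed (simp add: strip_left_def zeros_def)

lemma strip_right_decomp: "strip_right u @ zeros (length u - length (strip_right u)) = u"
  using arg_cong[OF strip_left_decomp[of "rev u"], of rev]
  by (simp add: strip_right_def zeros_def)

lemma length_strip_left: "length (strip_left u) \<le> length u"
  by (simp add: strip_left_def length_dropWhile_le)

lemma length_strip_right: "length (strip_right u) \<le> length u"
  using length_strip_left[of "rev u"] by (simp add: strip_right_def)

lemma hd_strip_left: "strip_left u = [] \<or> hd (strip_left u) \<noteq> 0"
  unfolding strip_left_def using hd_dropWhile by blast

lemma last_strip_right: "strip_right u = [] \<or> last (strip_right u) \<noteq> 0"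
  using hd_strip_left[of "rev u"] by (auto simp: strip_right_def last_rev)

lemma purify_strip_left [simp]: "purify (strip_left u) = purify u"
  using arg_cong[OF strip_left_decomp[of u], of purify] by (simp only: purify_append_zeros)

lemma purify_strip_right [simp]: "purify (strip_right u) = purify u"
  using arg_cong[OF strip_right_decomp[of u], of purify] by (simp only: purify_append_zeros)

lemma strip_left_zeros_append:
  assumes "w = [] \<or> hd w \<noteq> 0"
  shows "strip_left (zeros k @ w) = w"
  using assms by (cases w) (auto simp: strip_left_def zeros_def dropWhile_append)

lemma strip_right_append_zeros:
  assumes "w = [] \<or> last w \<noteq> 0"
  shows "strip_right (w @ zeros k) = w"
  using assms strip_left_zeros_append[of "rev w" k]
  by (auto simp: strip_right_def zeros_def hd_rev)

lemma set_subseq_zeros: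
  assumes "subseq w (zeros k)"
  shows "set w \<subseteq> {0}"
proof -
  obtain M where "w = nths (zeros k) M"
    using assms unfolding subseq_conv_nths ..
  then show ?thesis
    using subset_trans[OF set_nths_subset set_zeros] by simp
qed

text \<open>Split the embedding where the leading zeros of \<open>v\<close> end. The initial segment
  of \<open>w\<close> matched there consists of zeros, hence is empty because \<open>w\<close> does
  not start with 0.\<close>

lemma subseq_strip_left:
  assumes "w = [] \<or> hd w \<noteq> 0" and "subseq w v"
  shows "subseq w (strip_left v)"
proof -
  have "subseq w (zeros (length v - length (strip_left v)) @ strip_left v)"
    using assms(2) by (simp only: strip_left_decomp)
  then obtain w1 w2 where w: "w = w1 @ w2"
    "subseq w1 (zeros (length v - length (strip_left v)))" "subseq w2 (strip_left v)"
    unfolding subseq_append_iff by blast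
  have "set w1 \<subseteq> {0}"
    by (rule set_subseq_zeros[OF w(2)])
  then have "w1 = []"
    using assms(1) unfolding w(1) by (cases w1) auto
  then show ?thesis
    using w by simp
qed

text \<open>Here the segment matched in the trailing zeros is a final one, and it is empty because
  \<open>w\<close> does not end in 0.\<close>

lemma subseq_strip_right:
  assumes "w = [] \<or> last w \<noteq> 0" and "subseq w v"
  shows "subseq w (strip_right v)"
proof -
  have "subseq w (strip_right v @ zeros (length v - length (strip_right v)))"
    using assms(2) by (simp only: strip_right_decomp)
  then obtain w1 w2 where w: "w = w1 @ w2"
    "subseq w1 (strip_right v)" "subseq w2 (zeros (length v - length (strip_right v)))"
    unfolding subseq_append_iff by blast
  have "set w2 \<subseteq> {0}"
    by (rule set_subseq_zeros[OF w(3)])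
  then have "w2 = []"
    using assms(1) unfolding w(1) by (cases w2 rule: rev_cases) auto
  then show ?thesis
    using w by simp
qed

text \<open>Padding with zeros up to length \<open>N\<close> inverts the stripping, so prefixes can
  be indexed by words of length \<open>N\<close>.\<close>

lemma strip_right_image:
  assumes "\<gamma> \<in> pure_words_le d N"
  shows "strip_right ` words_over d N \<gamma> = prefixes_over d N \<gamma>"
proof (intro equalityI subsetI)
  fix w assume "w \<in> strip_right ` words_over d N \<gamma>"
  then show "w \<in> prefixes_over d N \<gamma>"
    using length_strip_right last_strip_right
    by (fastforce simp: prefixes_over_def words_over_eq[OF assms] words_le_over_eq[OF assms])
next
  fix w assume w: "w \<in> prefixes_over d N \<gamma>"
  then have "w @ zeros (N - length w) \<in> words_over d N \<gamma>"
    by (auto simp: prefixes_over_def words_over_eq[OF assms] words_le_over_eq[OF assms])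
  moreover have "w = strip_right (w @ zeros (N - length w))"
    using w by (simp add: prefixes_over_def strip_right_append_zeros)
  ultimately show "w \<in> strip_right ` words_over d N \<gamma>"
    by (rule rev_image_eqI)
qed

lemma strip_left_image:
  assumes "\<gamma> \<in> pure_words_le d N"
  shows "strip_left ` words_over d N \<gamma> = suffixes_over d N \<gamma>"
proof (intro equalityI subsetI)
  fix w assume "w \<in> strip_left ` words_over d N \<gamma>"
  then show "w \<in> suffixes_over d N \<gamma>"
    using length_strip_left hd_strip_left
    by (fastforce simp: suffixes_over_def words_over_eq[OF assms] words_le_over_eq[OF assms])
next
  fix w assume w: "w \<in> suffixes_over d N \<gamma>"
  then have "zeros (N - length w) @ w \<in> words_over d N \<gamma>"
    by (auto simp: suffixes_over_def words_over_eq[OF assms] words_le_over_eq[OF assms])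
  moreover have "w = strip_left (zeros (N - length w) @ w)"
    using w by (simp add: suffixes_over_def strip_left_zeros_append)
  ultimately show "w \<in> strip_left ` words_over d N \<gamma>"
    by (rule rev_image_eqI)
qed

section \<open>Triangularity for prefixes and suffixes\<close>

lemma basis_of_words_prefixes:
  assumes \<gamma>: "\<gamma> \<in> pure_words_le d N"
    and m: "\<And>w. w \<in> prefixes_over d N \<gamma> \<Longrightarrow> length w + m w \<le> N"
  shows "basis_of_words d N \<gamma> ((\<lambda>w. w @ zeros (m w)) ` prefixes_over d N \<gamma>)"
proof -
  have le: "length (strip_right u) + m (strip_right u) \<le> N" if "u \<in> words_over d N \<gamma>" for u
    using imageI[OF that, of strip_right] unfolding strip_right_image[OF \<gamma>] by (rule m)
  have "basis_of_words d N \<gamma>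
      ((\<lambda>u. strip_right u @ zeros (m (strip_right u))) ` words_over d N \<gamma>)"
  proof (rule basis_of_words_triangular[where h = "length \<circ> strip_right", OF \<gamma>])
    fix u assume u: "u \<in> words_over d N \<gamma>"
    have len: "length u = N"
      using u by (simp add: words_over_eq[OF \<gamma>])
    let ?w = "strip_right u" and ?m = "m (strip_right u)"
    show "?w @ zeros ?m \<in> words_le_over d N \<gamma>"
      using le[OF u] u by (simp add: words_over_eq[OF \<gamma>] words_le_over_eq[OF \<gamma>])
    \<comment> \<open>The bound on \<open>m\<close> rules out truncation: the zeros kept in the
      candidate and the padding together are exactly the zeros stripped from
      \<open>u\<close>.\<close>
    have "?m + (N - length (?w @ zeros ?m)) = length u - length ?w"
      using le[OF u] by (simp add: len)
    then have "(?w @ zeros ?m) @ zeros (N - length (?w @ zeros ?m)) = u"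
      using strip_right_decomp[of u] by (simp only: append.assoc flip: zeros_add)
    then show "u = (?w @ zeros ?m) @ zeros (N - length (?w @ zeros ?m)) \<or>
        u = zeros (N - length (?w @ zeros ?m)) @ (?w @ zeros ?m)"
      by (rule disjI1[OF sym])
    fix v assume v: "v \<in> words_over d N \<gamma>" and sub_v: "subseq (?w @ zeros ?m) v"
    have len_v: "length v = N"
      using v by (simp add: words_over_eq[OF \<gamma>])
    \<comment> \<open>The \<open>?m\<close> zeros of the candidate are discarded first, so the order
      depends only on prefixes and the choice of \<open>m\<close> is immaterial.\<close>
    have sub: "subseq ?w (strip_right v)"
      by (rule subseq_strip_right[OF last_strip_right
          subseq_order.trans[OF subseq_rev_drop_many[OF subseq_order.order_refl] sub_v]])
    show "v = u \<or> (length \<circ> strip_right) u < (length \<circ> strip_right) v"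
    \<comment> \<open>A subsequence of equal length is the whole word, and a prefix together with
      the total length \<open>N\<close> determines the word; otherwise the prefix of
      \<open>v\<close> is strictly longer.\<close>
    proof (cases "length ?w = length (strip_right v)")
      case True
      then have "?w = strip_right v"
        by (rule subseq_same_length[OF sub])
      then have "u = v"
        using len len_v by (metis strip_right_decomp)
      then show ?thesis
        by simp
    next
      case False
      then show ?thesis
        using list_emb_length[OF sub] by simp
    qed
  qed
  then show ?thesis
    by (simp add: image_image flip: strip_right_image[OF \<gamma>])
qed

lemma basis_of_words_suffixes:
  assumes \<gamma>: "\<gamma> \<in> pure_words_le d N"
    and m: "\<And>w. w \<in> suffixes_over d N \<gamma> \<Longrightarrow> length w + m w \<le> N"
  shows "basis_of_words d N \<gamma> ((\<lambda>w. zeros (m w) @ w) ` suffixes_over d N \<gamma>)"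
proof -
  have le: "length (strip_left u) + m (strip_left u) \<le> N" if "u \<in> words_over d N \<gamma>" for u
    using imageI[OF that, of strip_left] unfolding strip_left_image[OF \<gamma>] by (rule m)
  have "basis_of_words d N \<gamma>
      ((\<lambda>u. zeros (m (strip_left u)) @ strip_left u) ` words_over d N \<gamma>)"
  \<comment> \<open>Mirror image of the prefix argument: the level is the length of the suffix, and
    padding on the left recovers \<open>u\<close>.\<close>
  proof (rule basis_of_words_triangular[where h = "length \<circ> strip_left", OF \<gamma>])
    fix u assume u: "u \<in> words_over d N \<gamma>"
    have len: "length u = N"
      using u by (simp add: words_over_eq[OF \<gamma>])
    let ?w = "strip_left u" and ?m = "m (strip_left u)"
    show "zeros ?m @ ?w \<in> words_le_over d N \<gamma>"
      using le[OF u] u by (simp add: words_over_eq[OF \<gamma>] words_le_over_eq[OF \<gamma>])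
    have "(N - length (zeros ?m @ ?w)) + ?m = length u - length ?w"
      using le[OF u] by (simp add: len)
    then have "zeros (N - length (zeros ?m @ ?w)) @ (zeros ?m @ ?w) = u"
      using strip_left_decomp[of u] by (simp only: append.assoc[symmetric] flip: zeros_add)
    then show "u = (zeros ?m @ ?w) @ zeros (N - length (zeros ?m @ ?w)) \<or>
        u = zeros (N - length (zeros ?m @ ?w)) @ (zeros ?m @ ?w)"
      by (rule disjI2[OF sym])
    fix v assume v: "v \<in> words_over d N \<gamma>" and sub_v: "subseq (zeros ?m @ ?w) v"
    have len_v: "length v = N"
      using v by (simp add: words_over_eq[OF \<gamma>])
    have sub: "subseq ?w (strip_left v)"
      by (rule subseq_strip_left[OF hd_strip_left
          subseq_order.trans[OF subseq_drop_many[OF subseq_order.order_refl] sub_v]])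
    show "v = u \<or> (length \<circ> strip_left) u < (length \<circ> strip_left) v"
    proof (cases "length ?w = length (strip_left v)")
      case True
      then have "?w = strip_left v"
        by (rule subseq_same_length[OF sub])
      then have "u = v"
        using len len_v by (metis strip_left_decomp)
      then show ?thesis
        by simp
    next
      case False
      then show ?thesis
        using list_emb_length[OF sub] by simp
    qed
  qed
  then show ?thesis
    by (simp add: image_image flip: strip_left_image[OF \<gamma>])
qed

theorem theorem3:
  fixes d N :: nat and \<gamma> :: word
  assumes "d \<ge> 1"
    and "\<gamma> \<in> pure_words_le d N"
  shows "(\<forall>m :: word \<Rightarrow> nat.
            (\<forall>w\<in>prefixes_over d N \<gamma>. length w + m w \<le> N) \<longrightarrow>
            basis_of_words d N \<gamma> ((\<lambda>w. w @ zeros (m w)) ` prefixes_over d N \<gamma>)) \<and>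
         (\<forall>m :: word \<Rightarrow> nat.
            (\<forall>w\<in>suffixes_over d N \<gamma>. length w + m w \<le> N) \<longrightarrow>
            basis_of_words d N \<gamma> ((\<lambda>w. zeros (m w) @ w) ` suffixes_over d N \<gamma>))"
  using basis_of_words_prefixes[OF assms(2)] basis_of_words_suffixes[OF assms(2)] by blast

end
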